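(* Let $L\ge\mu>0$, $\kappa=L/\mu$, $\alpha=\sqrt{2\mu/L}=\sqrt{2/\kappa}$, and assume $f\in\mathcal S_{\mu,L}^{\rm LAS}(x^\star)$ on $\mathbb R^d$. Let $(x_k,y_k)_{k\ge0}$ be generated by the HNAG$^{++}$ algorithm (defined in the context). Let $\omega_k$ be as defined in the context, and set $K:=\min\{k\ge0:\omega_k\le 1/8\}$. Then there exist nonnegative sequences $\{\mu_k\},\{\delta_k\},\{b_k\},\{c_k\}$ and a constant $C>0$ such that $$\mu_k=(1-\delta_k)\mu,\qquad \delta_k\downarrow 0,\qquad b_k\to0,\qquad c_k=2-\sqrt{\delta_k}-b_k\to 2,$$ and, for all $k\ge0$, $$\frac{\mu}{2}\|y_{k+1}-x^\star\|^2\le\widetilde{\mathcal E}(\boldsymbol z_{k+1};\mu_{k+1})\le C\prod_{i=0}^k r_i ,$$ where, with $\boldsymbol z_k=(x_k,y_k)$ and $f_k(x):=f(x)-\frac{\mu_k}{2}\|x-x^\star\|^2$, $$\widetilde{\mathcal E}(\boldsymbol z_k;\mu_k):=D_{f_k}(x_k,x^\star)+\frac{\mu}{2}\|y_k-x^\star\|^2-\frac{1}{2L}\|\nabla f_k(x_k)\|^2,$$ $$r_k:=\begin{cases}(1+\alpha)^{-1},&0\le k<K,\\ \left(1+c_k\alpha-\Delta\delta_k\,\alpha^2\right)^{-1},&k\ge K,\end{cases}\qquad \Delta\delta_k:=\delta_k-\delta_{k+1}.$$ Consequently, $\widetilde{\mathcal E}(\boldsymbol z_k;\mu_k)$ and $\|y_k-x^\star\|^2$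 converge $R$-linearly with asymptotic rate $$r_\ast=\frac{1}{1+2\sqrt{2/\kappa}}=1-2\sqrt{2/\kappa}+O(\kappa^{-1})\quad\text{as }\kappa\to\infty .$$
   Context: $\mathcal S_{\mu,L}$ is the class of differentiable functions $f:\mathbb R^d\to\mathbb R$ that are $\mu$-strongly convex ($D_f(y,x)\ge\frac{\mu}{2}\|y-x\|^2$ for all $x,y$) and $L$-smooth ($\nabla f$ is $L$-Lipschitz); $x^\star$ is the unique minimizer of $f$. The Bregman divergence is $D_g(y,x):=g(y)-g(x)-\langle\nabla g(x),y-x\rangle$, and $\Delta_f(x,y):=D_f(y,x)-D_f(x,y)$. LAS class: $f\in\mathcal S_{\mu,L}^{\rm LAS}(x^\star)$ means $f\in\mathcal S_{\mu,L}$, $x^\star$ is its minimizer, and $\lim_{x\to x^\star}|\Delta_f(x,x^\star)|/D_f(x,x^\star)=0$. Define $\omega(R):=\sup_{0<\|x-x^\star\|\le R}|\Delta_f(x,x^\star)|/D_f(x,x^\star)$ for $R>0$, and $\omega(0):=0$. HNAG$^{++}$ algorithm: given $x_0,v_0\in\mathbb R^d$ and $\alpha=\sqrt{2\mu/L}$, for $k=0,1,2,\dots$ $$v_{k+1}=\frac{1}{1+\alpha}\Bigl(v_k+\alpha^2x_k-\frac2L\nabla f(x_k)\Bigr),\qquad x_{k+1}=\frac1{1+\alpha}\Bigl(x_k+v_{k+1}-\frac1L\nabla f(x_k)\Bigr),$$ and $y_k:=v_{k+1}/\alpha$. Equivalently, for arbitrary $x_0,y_0$ and with $\alpha\beta=1/L$: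 $\frac{x_{k+1}-x_k}{\alpha}=y_k-x_{k+1}-\beta\nabla f(x_k)$, $\frac{y_{k+1}-y_k}{\alpha}=x_{k+1}-y_{k+1}-\frac1\mu\nabla f(x_{k+1})$. Definition of $\omega_k$: let $\rho=\mu/L$, $\widetilde E_0:=f(x_0)-f(x^\star)+\frac\mu2\|y_0-x^\star\|^2-\frac1{2L}\|\nabla f(x_0)\|^2$ (which is $\ge0$), $C_1:=\bigl(\frac{2(1+2\alpha)}{\alpha\mu}\widetilde E_0\bigr)^{1/2}$, and $\omega_k:=\omega\bigl(C_1(1+\sqrt{2\rho})^{-(k+1)/2}\bigr)$. $\delta_k\downarrow0$ means $\{\delta_k\}$ is nonincreasing with limit $0$. A nonnegative sequence $\{E_k\}$ converges $R$-linearly with asymptotic rate $r$ if $\limsup_{k\to\infty}E_k^{1/k}\le r$. *)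

theory Defs
  imports "HOL-Analysis.Analysis" "HOL-Library.Landau_Symbols"
begin

text \<open>Gradient with respect to the inner product; the value is meaningful only where the
  function is differentiable.\<close>

definition grad :: "('a::euclidean_space \<Rightarrow> real) \<Rightarrow> 'a \<Rightarrow> 'a" where
  "grad f x = (THE D. GDERIV f x :> D)"

definition bregman :: "('a::euclidean_space \<Rightarrow> real) \<Rightarrow> 'a \<Rightarrow> 'a \<Rightarrow> real" where
  "bregman g y x = g y - g x - inner (grad g x) (y - x)"

definition bregman_asym :: "('a::euclidean_space \<Rightarrow> real) \<Rightarrow> 'a \<Rightarrow> 'a \<Rightarrow> real" where
  "bregman_asym f x y = bregman f y x - bregman f x y"

definition sc_smooth :: "real \<Rightarrow> real \<Rightarrow> ('a::euclidean_space \<Rightarrow> real) \<Rightarrow> bool" where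
  "sc_smooth \<mu> L f \<longleftrightarrow>
     (\<forall>x. f differentiable (at x)) \<and>
     (\<forall>x y. bregman f y x \<ge> \<mu> / 2 * (norm (y - x))\<^sup>2) \<and>
     lipschitz_on L UNIV (grad f)"

text \<open>The minimizer \<open>xs\<close> is necessarily unique when \<open>\<mu> > 0\<close>.\<close>

definition LAS :: "real \<Rightarrow> real \<Rightarrow> 'a \<Rightarrow> ('a::euclidean_space \<Rightarrow> real) \<Rightarrow> bool" where
  "LAS \<mu> L xs f \<longleftrightarrow>
     sc_smooth \<mu> L f \<and>
     (\<forall>x. f xs \<le> f x) \<and>
     ((\<lambda>x. \<bar>bregman_asym f x xs\<bar> / bregman f x xs) \<longlongrightarrow> 0) (at xs)"

text \<open>For \<open>f\<close> strongly convex and smooth the quotients are bounded, so the real supremum is the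
  genuine one. The modulus is only used for \<open>R \<ge> 0\<close>.\<close>

definition asym_modulus :: "('a::euclidean_space \<Rightarrow> real) \<Rightarrow> 'a \<Rightarrow> real \<Rightarrow> real" where
  "asym_modulus f xs R =
     (if R = 0 then 0
      else (SUP x\<in>{x. 0 < norm (x - xs) \<and> norm (x - xs) \<le> R}.
              \<bar>bregman_asym f x xs\<bar> / bregman f x xs))"

definition hnag_alpha :: "real \<Rightarrow> real \<Rightarrow> real" where
  "hnag_alpha \<mu> L = sqrt (2 * \<mu> / L)"

text \<open>The sequences \<open>x\<close>, \<open>v\<close>, \<open>y\<close> form a run of HNAG++, with arbitrary starting
  points \<open>x 0\<close> and \<open>v 0\<close>.\<close>

definition hnag_pp ::
  "real \<Rightarrow> real \<Rightarrow> ('a::euclidean_space \<Rightarrow> real) \<Rightarrow> (nat \<Rightarrow> 'a) \<Rightarrow> (nat \<Rightarrow> 'a) \<Rightarrow> (nat \<Rightarrow> 'a) \<Rightarrow> bool" where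
  "hnag_pp \<mu> L f x v y \<longleftrightarrow>
     (let \<alpha> = hnag_alpha \<mu> L in
      \<forall>k. v (Suc k) = (1 / (1 + \<alpha>)) *\<^sub>R (v k + \<alpha>\<^sup>2 *\<^sub>R x k - (2 / L) *\<^sub>R grad f (x k)) \<and>
          x (Suc k) = (1 / (1 + \<alpha>)) *\<^sub>R (x k + v (Suc k) - (1 / L) *\<^sub>R grad f (x k)) \<and>
          y k = (1 / \<alpha>) *\<^sub>R v (Suc k))"

definition shifted :: "('a::euclidean_space \<Rightarrow> real) \<Rightarrow> 'a \<Rightarrow> real \<Rightarrow> 'a \<Rightarrow> real" where
  "shifted f xs m = (\<lambda>x. f x - m / 2 * (norm (x - xs))\<^sup>2)"

text \<open>Lyapunov function at the state \<open>(x, y)\<close> with shift parameter \<open>m\<close>.\<close>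

definition lyap ::
  "real \<Rightarrow> real \<Rightarrow> ('a::euclidean_space \<Rightarrow> real) \<Rightarrow> 'a \<Rightarrow> 'a \<times> 'a \<Rightarrow> real \<Rightarrow> real" where
  "lyap \<mu> L f xs z m =
     (case z of (x, y) \<Rightarrow>
       bregman (shifted f xs m) x xs + \<mu> / 2 * (norm (y - xs))\<^sup>2
         - 1 / (2 * L) * (norm (grad (shifted f xs m) x))\<^sup>2)"

definition lyap_init ::
  "real \<Rightarrow> real \<Rightarrow> ('a::euclidean_space \<Rightarrow> real) \<Rightarrow> 'a \<Rightarrow> 'a \<Rightarrow> 'a \<Rightarrow> real" where
  "lyap_init \<mu> L f xs x0 y0 =
     f x0 - f xs + \<mu> / 2 * (norm (y0 - xs))\<^sup>2 - 1 / (2 * L) * (norm (grad f x0))\<^sup>2"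

definition hnag_C1 ::
  "real \<Rightarrow> real \<Rightarrow> ('a::euclidean_space \<Rightarrow> real) \<Rightarrow> 'a \<Rightarrow> 'a \<Rightarrow> 'a \<Rightarrow> real" where
  "hnag_C1 \<mu> L f xs x0 y0 =
     (let \<alpha> = hnag_alpha \<mu> L in
      sqrt (2 * (1 + 2 * \<alpha>) / (\<alpha> * \<mu>) * lyap_init \<mu> L f xs x0 y0))"

definition hnag_omega ::
  "real \<Rightarrow> real \<Rightarrow> ('a::euclidean_space \<Rightarrow> real) \<Rightarrow> 'a \<Rightarrow> 'a \<Rightarrow> 'a \<Rightarrow> nat \<Rightarrow> real" where
  "hnag_omega \<mu> L f xs x0 y0 k =
     (let \<rho> = \<mu> / L in
      asym_modulus f xs
        (hnag_C1 \<mu> L f xs x0 y0 * (1 + sqrt (2 * \<rho>)) powr (- (real k + 1) / 2)))"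

definition hnag_rate :: "real \<Rightarrow> nat \<Rightarrow> (nat \<Rightarrow> real) \<Rightarrow> (nat \<Rightarrow> real) \<Rightarrow> nat \<Rightarrow> real" where
  "hnag_rate \<alpha> K c \<delta> k =
     (if k < K then inverse (1 + \<alpha>)
      else inverse (1 + c k * \<alpha> - (\<delta> k - \<delta> (Suc k)) * \<alpha>\<^sup>2))"

text \<open>R-linear convergence with asymptotic rate \<open>r\<close>. Since \<open>root 0\<close> is \<open>0\<close>, the
  term for \<open>k = 0\<close> is harmless.\<close>

definition R_linear :: "(nat \<Rightarrow> real) \<Rightarrow> real \<Rightarrow> bool" where
  "R_linear E r \<longleftrightarrow>
     (\<forall>k. 0 \<le> E k) \<and> limsup (\<lambda>k. ereal (root k (E k))) \<le> ereal r"

end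

theory Submission
  imports Defs
begin

text \<open>
  Write \<open>g\<close> for the shifted function \<open>f - m/2 \<parallel>x - x\<^sup>*\<parallel>\<^sup>2\<close> with \<open>0 \<le> m \<le> \<mu>\<close>, and \<open>E\<close> for the
  Lyapunov function at shift \<open>m\<close>. Because \<open>\<alpha>\<^sup>2 = 2\<mu>/L\<close>, the cross terms produced by one step of
  the method cancel against the term \<open>- \<parallel>\<nabla>g\<parallel>\<^sup>2/(2L)\<close> and against the cocoercivity of \<open>\<nabla>g\<close>, which
  leaves (lemma \<open>lyap_step\<close>, in coordinates centred at \<open>x\<^sup>*\<close>)
  \<open>E\<^sup>+ - E \<le> - \<alpha> (\<langle>\<nabla>g(x\<^sup>+), x\<^sup>+\<rangle> + \<mu> \<parallel>y\<^sup>+\<parallel>\<^sup>2 - (\<mu> - m) \<langle>x\<^sup>+, y\<^sup>+\<rangle>)\<close>.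

  Strong convexity alone bounds the bracket below by \<open>E\<^sup>+\<close>, for every \<open>m\<close>. This gives the rate
  \<open>1/(1 + \<alpha>)\<close>, and for \<open>m = \<mu>/2\<close> the Lyapunov function controls \<open>\<parallel>x - x\<^sup>*\<parallel>\<^sup>2\<close>, so that
  \<open>x\<^sub>k \<rightarrow> x\<^sup>*\<close> (\<open>hnag_iterates_tendsto\<close>).

  The inner product \<open>\<langle>\<nabla>g(x), x\<rangle>\<close> is the sum of the two Bregman divergences between \<open>x\<close> and
  \<open>x\<^sup>*\<close>. If these were equal, it would be \<open>2 D\<^sub>g(x, x\<^sup>*)\<close>, and the rate would double to
  \<open>1/(1 + 2\<alpha>)\<close>, up to the cross term \<open>(\<mu> - m) \<langle>x, y\<rangle>\<close>. For \<open>m = (1 - \<delta>)\<mu>\<close> the cross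
  term costs \<open>\<surd>\<delta>\<close>. The asymmetry of \<open>g\<close> is that of \<open>f\<close>, but it has to be measured
  against \<open>D\<^sub>g\<close>, which can be smaller than \<open>D\<^sub>f\<close> by a factor \<open>\<delta>\<close>; an asymmetry of at most
  \<open>\<delta>\<^sup>2 D\<^sub>f\<close> therefore costs \<open>\<delta>\<close> (\<open>lyap_contracts_asym\<close>). Passing from \<open>\<delta>\<^sub>k\<close> to \<open>\<delta>\<^sub>k\<^sub>+\<^sub>1\<close>
  in the Lyapunov function costs a multiple of \<open>\<delta>\<^sub>k - \<delta>\<^sub>k\<^sub>+\<^sub>1\<close> (\<open>lyap_shift_increment\<close>).

  Since \<open>x\<^sub>k \<rightarrow> x\<^sup>*\<close>, the relative asymmetry along the iterates tends to \<open>0\<close>, and its square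
  root has a nonincreasing majorant with limit \<open>0\<close>. A tail of this majorant, extended to the
  left by a constant, serves as \<open>\<delta>\<close>, and \<open>b\<close> collects all losses except \<open>\<surd>\<delta>\<close>. The
  one-step estimate holds from some index on; the finitely many steps before it only affect the
  constant \<open>C\<close>, as all factors \<open>r\<^sub>k\<close> are positive.
\<close>

section \<open>Gradients and Bregman divergences\<close>

lemma GDERIV_unique:
  assumes "GDERIV f x :> D" "GDERIV f x :> D'"
  shows "D = D'"
proof -
  have "(\<lambda>h. inner h D) = (\<lambda>h. inner h D')"
    using assms unfolding gderiv_def by (rule has_derivative_unique)
  then have "inner (D - D') D = inner (D - D') D'" by metis
  then have "inner (D - D') (D - D') = 0" by (simp add: inner_diff_right)
  then show ?thesis by simp
qed

lemma grad_eqI: "GDERIV f x :> D \<Longrightarrow> grad f x = D"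
  unfolding grad_def by (blast intro: GDERIV_unique)

text \<open>In finite dimension the derivative, a linear functional, is represented by a vector.\<close>

lemma GDERIV_grad:
  fixes f :: "'a::euclidean_space \<Rightarrow> real"
  assumes "f differentiable (at x)"
  shows "GDERIV f x :> grad f x"
proof -
  obtain f' where f': "(f has_derivative f') (at x)"
    using assms unfolding differentiable_def by blast
  then have lin: "linear f'" by (rule has_derivative_linear)
  define D where "D = (\<Sum>b\<in>Basis. f' b *\<^sub>R b)"
  have "f' h = inner h D" for h
  proof -
    have "f' h = f' (\<Sum>b\<in>Basis. inner h b *\<^sub>R b)" by (simp add: euclidean_representation)
    also have "\<dots> = inner h D"
      by (simp add: D_def linear_sum[OF lin] linear_scale[OF lin] inner_sum_right mult.commute)
    finally show ?thesis .
  qed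
  then have "f' = (\<lambda>h. inner h D)" by blast
  then have "GDERIV f x :> D" using f' by (simp add: gderiv_def)
  then show ?thesis using grad_eqI by blast
qed

lemma grad_shifted:
  assumes "f differentiable (at x)"
  shows "grad (shifted f xs m) x = grad f x - m *\<^sub>R (x - xs)"
proof (rule grad_eqI)
  have "(f has_derivative (\<lambda>h. inner h (grad f x))) (at x)"
    using GDERIV_grad[OF assms] by (simp add: gderiv_def)
  then show "GDERIV (shifted f xs m) x :> grad f x - m *\<^sub>R (x - xs)"
    unfolding gderiv_def shifted_def power2_norm_eq_inner
    by (auto intro!: derivative_eq_intros simp: inner_simps inner_commute algebra_simps)
qed

lemma grad_minimizer:
  assumes "f differentiable (at z)" and "\<And>x. f z \<le> f x"
  shows "grad f z = 0"
proof -
  have "(f has_derivative (\<lambda>h. inner h (grad f z))) (at z)"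
    using GDERIV_grad[OF assms(1)] by (simp add: gderiv_def)
  then have "(\<lambda>h. inner h (grad f z)) = (\<lambda>h. 0)"
    using assms(2) by (intro differential_zero_maxmin[of z UNIV f]) auto
  then have "inner (grad f z) (grad f z) = 0" by metis
  then show ?thesis by simp
qed

lemma norm_sq_add_scaled:
  fixes a b :: "'a::real_inner"
  shows "(norm (a + t *\<^sub>R b))\<^sup>2 = (norm a)\<^sup>2 + 2 * t * inner a b + t\<^sup>2 * (norm b)\<^sup>2"
  unfolding power2_norm_eq_inner power2_eq_square[of t]
  by (simp add: inner_add_left inner_add_right inner_commute algebra_simps)

lemma bregman_shifted:
  assumes "f differentiable (at z)"
  shows "bregman (shifted f xs m) x z = bregman f x z - m / 2 * (norm (x - z))\<^sup>2"
  unfolding bregman_def grad_shifted[OF assms]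
  by (simp add: shifted_def power2_norm_eq_inner inner_simps inner_commute field_simps)

text \<open>The descent lemma. Along the segment from \<open>x\<close> to \<open>y\<close>, the gap between \<open>f\<close> and its quadratic
  upper model has nonpositive derivative, by the Lipschitz bound on the gradient.\<close>

lemma bregman_le_of_lipschitz:
  fixes f :: "'a::euclidean_space \<Rightarrow> real"
  assumes diff: "\<And>x. f differentiable (at x)" and lip: "lipschitz_on L UNIV (grad f)"
  shows "bregman f y x \<le> L / 2 * (norm (y - x))\<^sup>2"
proof -
  define h where "h = y - x"
  define \<phi> where "\<phi> t = f (x + t *\<^sub>R h) - t * inner (grad f x) h - L / 2 * t\<^sup>2 * (norm h)\<^sup>2" for t
  have "\<phi> 1 \<le> \<phi> 0"
  proof (rule DERIV_nonpos_imp_nonincreasing[where f = \<phi>])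
    fix t :: real assume t: "0 \<le> t" "t \<le> 1"
    let ?D = "inner h (grad f (x + t *\<^sub>R h)) - inner (grad f x) h - L * t * (norm h)\<^sup>2"
    have f': "(f has_derivative (\<lambda>u. inner u (grad f (x + t *\<^sub>R h)))) (at (x + t *\<^sub>R h))"
      using GDERIV_grad[OF diff] by (simp add: gderiv_def)
    have "((\<lambda>t. x + t *\<^sub>R h) has_derivative (\<lambda>s. s *\<^sub>R h)) (at t)"
      by (auto intro!: derivative_eq_intros)
    from has_derivative_compose[OF this f']
    have "((\<lambda>t. f (x + t *\<^sub>R h)) has_real_derivative inner h (grad f (x + t *\<^sub>R h))) (at t)"
      by (simp add: has_field_derivative_def mult_commute_abs)
    then have "(\<phi> has_real_derivative ?D) (at t)"
      unfolding \<phi>_def by (auto intro!: derivative_eq_intros)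
    moreover have "?D \<le> 0"
    proof -
      have "inner h (grad f (x + t *\<^sub>R h)) - inner (grad f x) h
          = inner h (grad f (x + t *\<^sub>R h) - grad f x)"
        by (simp add: inner_simps inner_commute)
      also have "\<dots> \<le> norm h * norm (grad f (x + t *\<^sub>R h) - grad f x)"
        by (rule norm_cauchy_schwarz)
      also have "\<dots> \<le> norm h * (L * norm (t *\<^sub>R h))"
        using lipschitz_onD[OF lip, of "x + t *\<^sub>R h" x]
        by (intro mult_left_mono) (auto simp: dist_norm)
      also have "\<dots> = L * t * (norm h)\<^sup>2" using t by (simp add: power2_eq_square)
      finally show ?thesis by simp
    qed
    ultimately show "\<exists>D. (\<phi> has_real_derivative D) (at t) \<and> D \<le> 0" by blast
  qed simp
  then show ?thesis by (simp add: \<phi>_def h_def bregman_def)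
qed

text \<open>Cocoercivity. Convexity makes the divergence at \<open>w\<close> from \<open>z\<close> nonnegative, while the
  three-point identity through \<open>x\<close> and smoothness bound it above; the gradient step
  \<open>w = x - \<Delta>/M\<close> is the optimal test point. If \<open>M = 0\<close>, arbitrarily long steps are allowed,
  which forces \<open>\<Delta> = 0\<close>.\<close>

lemma grad_diff_le_bregman:
  fixes g :: "'a::euclidean_space \<Rightarrow> real"
  assumes conv: "\<And>x y. 0 \<le> bregman g y x"
    and smooth: "\<And>x y. bregman g y x \<le> M / 2 * (norm (y - x))\<^sup>2" and "0 \<le> M"
  shows "(norm (grad g x - grad g z))\<^sup>2 \<le> 2 * M * bregman g x z"
proof -
  define \<Delta> where "\<Delta> = grad g x - grad g z"
  have key: "t * (norm \<Delta>)\<^sup>2 \<le> M / 2 * t\<^sup>2 * (norm \<Delta>)\<^sup>2 + bregman g x z" for t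
  proof -
    define w where "w = x - t *\<^sub>R \<Delta>"
    have "bregman g w z = bregman g w x + bregman g x z + inner \<Delta> (w - x)"
      by (simp add: bregman_def \<Delta>_def inner_simps)
    moreover have "inner \<Delta> (w - x) = - t * (norm \<Delta>)\<^sup>2"
      by (simp add: w_def power2_norm_eq_inner)
    moreover have "bregman g w x \<le> M / 2 * t\<^sup>2 * (norm \<Delta>)\<^sup>2"
      using smooth[of w x] by (simp add: w_def power_mult_distrib)
    ultimately show ?thesis using conv[of w z] by simp
  qed
  show ?thesis
  proof (cases "M = 0")
    case False
    then show ?thesis using key[of "1 / M"] \<open>0 \<le> M\<close>
      by (simp add: \<Delta>_def power2_eq_square field_simps)
  next
    case True
    have "(norm \<Delta>)\<^sup>2 \<le> 0"
    proof (rule ccontr)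
      assume "\<not> ?thesis"
      then show False
        using key[of "(bregman g x z + 1) / (norm \<Delta>)\<^sup>2"] True by simp
    qed
    then show ?thesis using True by (simp add: \<Delta>_def)
  qed
qed

lemma shifted_bregman_bounds:
  fixes f :: "'a::euclidean_space \<Rightarrow> real"
  assumes "sc_smooth \<mu> L f"
  shows "(\<mu> - m) / 2 * (norm (y - x))\<^sup>2 \<le> bregman (shifted f xs m) y x"
    and "bregman (shifted f xs m) y x \<le> (L - m) / 2 * (norm (y - x))\<^sup>2"
proof -
  have d: "f differentiable (at z)" for z using assms by (simp add: sc_smooth_def)
  have "bregman f y x \<ge> \<mu> / 2 * (norm (y - x))\<^sup>2" using assms by (simp add: sc_smooth_def)
  moreover have "bregman f y x \<le> L / 2 * (norm (y - x))\<^sup>2"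
    using assms by (intro bregman_le_of_lipschitz) (auto simp: sc_smooth_def)
  ultimately show "(\<mu> - m) / 2 * (norm (y - x))\<^sup>2 \<le> bregman (shifted f xs m) y x"
    and "bregman (shifted f xs m) y x \<le> (L - m) / 2 * (norm (y - x))\<^sup>2"
    unfolding bregman_shifted[OF d] by (simp_all add: left_diff_distrib diff_divide_distrib)
qed

lemma shifted_grad_diff_le:
  fixes f :: "'a::euclidean_space \<Rightarrow> real" and xs :: 'a
  assumes "sc_smooth \<mu> L f" "m \<le> \<mu>" "\<mu> \<le> L"
  defines "g \<equiv> shifted f xs m"
  shows "(norm (grad g x - grad g z))\<^sup>2 \<le> 2 * (L - m) * bregman g x z"
proof (rule grad_diff_le_bregman)
  fix x y :: 'a
  have "0 \<le> (\<mu> - m) / 2 * (norm (y - x))\<^sup>2" using assms by simp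
  then show "0 \<le> bregman g y x"
    using shifted_bregman_bounds(1)[OF assms(1), of m y x xs] by (simp add: g_def)
  show "bregman g y x \<le> (L - m) / 2 * (norm (y - x))\<^sup>2"
    using shifted_bregman_bounds(2)[OF assms(1)] by (simp add: g_def)
qed (use assms in simp)

section \<open>One step of the method\<close>

locale smooth_minimization =
  fixes \<mu> L \<alpha> :: real and f :: "'a::euclidean_space \<Rightarrow> real" and xs :: 'a
  assumes \<mu>_pos: "0 < \<mu>" and \<mu>_le_L: "\<mu> \<le> L"
    and \<alpha>_def: "\<alpha> = hnag_alpha \<mu> L"
    and smooth: "sc_smooth \<mu> L f"
    and minimizer: "\<And>x. f xs \<le> f x"
begin

text \<open>The iteration in the variables \<open>(x, y)\<close>, without the auxiliary sequence \<open>v\<close>: its two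
  implicit Euler-type updates, each solved for the multiple \<open>1 + \<alpha>\<close> of the new point.\<close>

definition hnag_step :: "'a \<times> 'a \<Rightarrow> 'a \<times> 'a \<Rightarrow> bool" where
  "hnag_step z z' \<longleftrightarrow> (case (z, z') of ((x, y), (x', y')) \<Rightarrow>
     (1 + \<alpha>) *\<^sub>R x' = x + \<alpha> *\<^sub>R y - (1 / L) *\<^sub>R grad f x \<and>
     (1 + \<alpha>) *\<^sub>R y' = y + \<alpha> *\<^sub>R x' - (\<alpha> / \<mu>) *\<^sub>R grad f x')"

lemma L_pos: "0 < L" using \<mu>_pos \<mu>_le_L by simp

lemma \<alpha>_pos: "0 < \<alpha>" using \<mu>_pos L_pos by (simp add: \<alpha>_def hnag_alpha_def)

lemma \<alpha>_sq: "\<alpha>\<^sup>2 = 2 * \<mu> / L" using \<mu>_pos L_pos by (simp add: \<alpha>_def hnag_alpha_def)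

lemma differentiable: "f differentiable (at x)" using smooth by (simp add: sc_smooth_def)

lemma grad_xs: "grad f xs = 0" by (rule grad_minimizer[OF differentiable minimizer])

lemma grad_shifted_xs: "grad (shifted f xs m) xs = 0"
  by (simp add: grad_shifted[OF differentiable] grad_xs)

lemma bregman_shifted_xs: "bregman (shifted f xs m) x xs = shifted f xs m x - f xs"
  by (simp only: bregman_def grad_shifted_xs) (simp add: shifted_def)

lemma bregman_shifted_nonneg: "m \<le> \<mu> \<Longrightarrow> 0 \<le> bregman (shifted f xs m) x z"
  using shifted_bregman_bounds(1)[OF smooth, of m x z xs]
  by (smt (verit) mult_nonneg_nonneg zero_le_power2 divide_nonneg_nonneg)

lemma lyap_eq:
  "lyap \<mu> L f xs (x, y) m = bregman (shifted f xs m) x xs + \<mu> / 2 * (norm (y - xs))\<^sup>2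
     - 1 / (2 * L) * (norm (grad (shifted f xs m) x))\<^sup>2"
  by (simp add: lyap_def)

text \<open>The shifted function is only \<open>(L - m)\<close>-smooth, so the subtracted gradient term, which is
  scaled with \<open>L\<close>, leaves the fraction \<open>m/L\<close> of the divergence. For \<open>m > 0\<close> this is what lets
  the Lyapunov function control \<open>x\<close>.\<close>

lemma lyap_lower_bound:
  assumes "m \<le> \<mu>"
  shows "m / L * bregman (shifted f xs m) x xs + \<mu> / 2 * (norm (y - xs))\<^sup>2 \<le> lyap \<mu> L f xs (x, y) m"
proof -
  have "(norm (grad (shifted f xs m) x))\<^sup>2 \<le> 2 * (L - m) * bregman (shifted f xs m) x xs"
    using shifted_grad_diff_le[OF smooth assms \<mu>_le_L, of xs x xs] by (simp add: grad_shifted_xs)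
  then have "1 / (2 * L) * (norm (grad (shifted f xs m) x))\<^sup>2
      \<le> 1 / (2 * L) * (2 * (L - m) * bregman (shifted f xs m) x xs)"
    using L_pos by (intro mult_left_mono) auto
  also have "\<dots> = bregman (shifted f xs m) x xs - m / L * bregman (shifted f xs m) x xs"
    using L_pos by (simp add: field_simps)
  finally show ?thesis by (simp add: lyap_eq)
qed

lemma lyap_ge_dist:
  assumes "0 \<le> m" "m \<le> \<mu>"
  shows "\<mu> / 2 * (norm (y - xs))\<^sup>2 \<le> lyap \<mu> L f xs (x, y) m"
  using lyap_lower_bound[OF assms(2), of x y] bregman_shifted_nonneg[OF assms(2), of x xs] assms L_pos
  by (smt (verit) mult_nonneg_nonneg divide_nonneg_pos)

lemma lyap_nonneg:
  assumes "0 \<le> m" "m \<le> \<mu>"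
  shows "0 \<le> lyap \<mu> L f xs (x, y) m"
  using lyap_ge_dist[OF assms, of y x] \<mu>_pos by (smt (verit) mult_nonneg_nonneg zero_le_power2 divide_nonneg_pos)

lemma lyap_le:
  "lyap \<mu> L f xs (x, y) m \<le> bregman (shifted f xs m) x xs + \<mu> / 2 * (norm (y - xs))\<^sup>2"
  using L_pos by (simp add: lyap_eq)

lemma inner_grad_shifted:
  "inner (grad (shifted f xs m) x) (x - xs)
     = bregman (shifted f xs m) x xs + bregman (shifted f xs m) xs x"
  by (simp add: bregman_def grad_shifted_xs inner_simps)

text \<open>In the proof, \<open>G\<close> and \<open>G'\<close> are the gradients of \<open>g\<close> at the old and the new point. The
  cross term \<open>\<alpha> \<langle>G', u - w\<rangle>\<close> is absorbed by \<open>\<mu>/2 \<parallel>w - u\<parallel>\<^sup>2\<close> at the price of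
  \<open>\<alpha>\<^sup>2/(2\<mu>) \<parallel>G'\<parallel>\<^sup>2 = \<parallel>G'\<parallel>\<^sup>2/L\<close>. Together with \<open>- \<langle>G', G\<rangle>/L\<close>, which comes from the gradient
  step in \<open>x\<close>, and with the change of the subtracted gradient term, this is exactly
  \<open>\<parallel>G - G'\<parallel>\<^sup>2/(2L)\<close>, and cocoercivity bounds that by a fraction \<open>1 - m/L\<close> of \<open>D\<^sub>g(x, x')\<close>. The
  remaining fraction \<open>m/L\<close> of this divergence compensates the term \<open>- m/L \<langle>G', q\<rangle>\<close>, which has
  no sign of its own.\<close>

lemma lyap_step:
  assumes step: "hnag_step (x, y) (x', y')" and m: "0 \<le> m" "m \<le> \<mu>"
  shows "lyap \<mu> L f xs (x', y') m \<le> lyap \<mu> L f xs (x, y) m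
    - \<alpha> * (inner (grad (shifted f xs m) x') (x' - xs)
         + \<mu> * (norm (y' - xs))\<^sup>2 - (\<mu> - m) * inner (x' - xs) (y' - xs))"
proof -
  define g where "g = shifted f xs m"
  define p q w u where "p = x' - xs" and "q = x - xs" and "w = y' - xs" and "u = y - xs"
  define G G' where "G = grad g x" and "G' = grad g x'"
  have gf: "grad f x = G + m *\<^sub>R q" "grad f x' = G' + m *\<^sub>R p"
    by (simp_all add: G_def G'_def g_def q_def p_def grad_shifted[OF differentiable])
  have "p - q = \<alpha> *\<^sub>R (u - p) - (1 / L) *\<^sub>R (G + m *\<^sub>R q)"
    unfolding gf(1)[symmetric] using step
    by (simp add: hnag_step_def p_def q_def u_def algebra_simps)
  moreover have "w - u = \<alpha> *\<^sub>R (p - w) - (\<alpha> / \<mu>) *\<^sub>R (G' + m *\<^sub>R p)"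
    unfolding gf(2)[symmetric] using step
    by (simp add: hnag_step_def p_def w_def u_def algebra_simps)
  ultimately have "inner G' (p - q) = inner G' (\<alpha> *\<^sub>R (u - p) - (1 / L) *\<^sub>R (G + m *\<^sub>R q))"
    and "inner (w - u) w = inner (\<alpha> *\<^sub>R (p - w) - (\<alpha> / \<mu>) *\<^sub>R (G' + m *\<^sub>R p)) w"
    by simp_all
  then have 1: "inner G' (p - q) = \<alpha> * inner G' u - \<alpha> * inner G' p - inner G' G / L - m / L * inner G' q"
    and 2: "inner (w - u) w = \<alpha> * inner p w - \<alpha> * inner w w - \<alpha> / \<mu> * inner G' w - \<alpha> * m / \<mu> * inner p w"
    by (simp_all add: inner_add_left inner_add_right inner_diff_left inner_diff_right
        inner_commute[of p G'] field_simps)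
  have "\<mu> * inner (w - u) w = \<alpha> * (\<mu> - m) * inner p w - \<alpha> * \<mu> * inner w w - \<alpha> * inner G' w"
    unfolding 2 using \<mu>_pos by (simp add: field_simps)
  then have 3: "\<mu> / 2 * (norm w)\<^sup>2 - \<mu> / 2 * (norm u)\<^sup>2
      = \<alpha> * (\<mu> - m) * inner p w - \<alpha> * \<mu> * (norm w)\<^sup>2 - \<alpha> * inner G' w - \<mu> / 2 * (norm (w - u))\<^sup>2"
    by (simp add: power2_norm_eq_inner inner_simps inner_commute field_simps)
  have "0 \<le> \<mu> / 2 * (norm ((w - u) + (\<alpha> / \<mu>) *\<^sub>R G'))\<^sup>2" using \<mu>_pos by simp
  also have "\<dots> = \<mu> / 2 * (norm (w - u))\<^sup>2 + \<alpha> * inner G' (w - u) + \<alpha>\<^sup>2 / (2 * \<mu>) * (norm G')\<^sup>2"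
    unfolding norm_sq_add_scaled using \<mu>_pos
    by (simp add: inner_commute field_simps power2_eq_square)
  also have "\<alpha>\<^sup>2 / (2 * \<mu>) = 1 / L" using \<mu>_pos L_pos by (simp add: \<alpha>_sq)
  finally have 4: "\<alpha> * inner G' u - \<alpha> * inner G' w \<le> \<mu> / 2 * (norm (w - u))\<^sup>2 + (norm G')\<^sup>2 / L"
    by (simp add: inner_simps algebra_simps)
  have 5: "g x' - g x = inner G' (p - q) - bregman g x x'"
    by (simp add: bregman_def G'_def p_def q_def inner_simps)
  have "1 / (2 * L) * (norm (G - G'))\<^sup>2 \<le> 1 / (2 * L) * (2 * (L - m) * bregman g x x')"
    using shifted_grad_diff_le[OF smooth m(2) \<mu>_le_L, of xs x x'] L_pos
    by (intro mult_left_mono) (auto simp: G_def G'_def g_def)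
  also have "\<dots> = bregman g x x' - m / L * bregman g x x'"
    using L_pos by (simp add: field_simps)
  finally have 6: "((norm G)\<^sup>2 + (norm G')\<^sup>2 - 2 * inner G' G) / (2 * L)
      \<le> bregman g x x' - m / L * bregman g x x'"
    by (simp add: power2_norm_eq_inner inner_simps inner_commute)
  \<comment> \<open>the term caused by the shift gets a sign together with the divergence that cocoercivity
      leaves over: the sum is \<open>D\<^sub>g(x, x\<^sup>*) + D\<^sub>g(x\<^sup>*, x')\<close>\<close>
  have "inner G' q + bregman g x x' = g x - g x' + inner G' p"
    using 5 by (simp add: inner_simps)
  also have "\<dots> = bregman g x xs + bregman g xs x'"
    using inner_grad_shifted[of m x']
    by (simp add: bregman_shifted_xs g_def G'_def p_def)
  also have "0 \<le> \<dots>" unfolding g_def by (intro add_nonneg_nonneg bregman_shifted_nonneg m)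
  finally have 7: "0 \<le> m / L * inner G' q + m / L * bregman g x x'"
    using m L_pos unfolding distrib_left[symmetric] by (intro mult_nonneg_nonneg) auto
  have "g x' - g x + (\<mu> / 2 * (norm w)\<^sup>2 - \<mu> / 2 * (norm u)\<^sup>2)
        - 1 / (2 * L) * ((norm G')\<^sup>2 - (norm G)\<^sup>2)
      \<le> - \<alpha> * inner G' p + \<alpha> * (\<mu> - m) * inner p w - \<alpha> * \<mu> * (norm w)\<^sup>2"
  proof -
    have "(norm G')\<^sup>2 / L - inner G' G / L - 1 / (2 * L) * ((norm G')\<^sup>2 - (norm G)\<^sup>2)
        = ((norm G)\<^sup>2 + (norm G')\<^sup>2 - 2 * inner G' G) / (2 * L)"
      using L_pos by (simp add: field_simps)
    then show ?thesis using 1 3 4 5 6 7 by linarith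
  qed
  then show ?thesis
    unfolding lyap_eq bregman_shifted_xs
    by (simp add: g_def[symmetric] p_def w_def u_def G_def G'_def algebra_simps)
qed

text \<open>The baseline rate. It uses the divergence of \<open>x\<^sup>*\<close> from the new point only through its
  quadratic lower bound, which dominates the \<open>x\<close> part of the cross term.\<close>

lemma lyap_contracts:
  assumes step: "hnag_step (x, y) (x', y')" and m: "0 \<le> m" "m \<le> \<mu>"
  shows "(1 + \<alpha>) * lyap \<mu> L f xs (x', y') m \<le> lyap \<mu> L f xs (x, y) m"
proof -
  let ?g = "shifted f xs m"
  have "0 \<le> (norm (x' - xs - (y' - xs)))\<^sup>2" by simp
  then have "2 * inner (x' - xs) (y' - xs) \<le> (norm (x' - xs))\<^sup>2 + (norm (y' - xs))\<^sup>2"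
    by (simp add: power2_norm_eq_inner inner_simps inner_commute)
  then have "(\<mu> - m) / 2 * (2 * inner (x' - xs) (y' - xs))
      \<le> (\<mu> - m) / 2 * ((norm (x' - xs))\<^sup>2 + (norm (y' - xs))\<^sup>2)"
    using m by (intro mult_left_mono) auto
  moreover have "(\<mu> - m) / 2 * (norm (x' - xs))\<^sup>2 \<le> bregman ?g xs x'"
    using shifted_bregman_bounds(1)[OF smooth, of m xs x' xs] by (simp add: norm_minus_commute)
  moreover have "0 \<le> m / 2 * (norm (y' - xs))\<^sup>2" using m by simp
  ultimately have "bregman ?g x' xs + \<mu> / 2 * (norm (y' - xs))\<^sup>2
      \<le> inner (grad ?g x') (x' - xs) + \<mu> * (norm (y' - xs))\<^sup>2 - (\<mu> - m) * inner (x' - xs) (y' - xs)"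
    unfolding inner_grad_shifted by (simp add: field_simps)
  with lyap_le[of x' y' m] have "\<alpha> * lyap \<mu> L f xs (x', y') m
      \<le> \<alpha> * (inner (grad ?g x') (x' - xs) + \<mu> * (norm (y' - xs))\<^sup>2 - (\<mu> - m) * inner (x' - xs) (y' - xs))"
    using \<alpha>_pos by (intro mult_left_mono) auto
  then show ?thesis using lyap_step[OF step m] by (simp add: algebra_simps)
qed

text \<open>The quadratic shift is symmetric, so it leaves the asymmetry unchanged, but it shrinks the
  divergence: only \<open>\<delta> D\<^sub>f \<le> D\<^sub>g\<close> is guaranteed. One of the two factors \<open>\<delta>\<close> in the hypothesis
  is spent on this comparison.\<close>

lemma shifted_asym_bound:
  assumes asym: "\<bar>bregman_asym f x xs\<bar> \<le> \<delta>\<^sup>2 * bregman f x xs" and \<delta>: "0 \<le> \<delta>" "\<delta> \<le> 1"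
  defines "g \<equiv> shifted f xs ((1 - \<delta>) * \<mu>)"
  shows "\<delta> * \<mu> / 2 * (norm (x - xs))\<^sup>2 \<le> bregman g x xs"
    and "\<bar>inner (grad g x) (x - xs) - 2 * bregman g x xs\<bar> \<le> \<delta> * bregman g x xs"
proof -
  have "(\<mu> - (1 - \<delta>) * \<mu>) / 2 * (norm (x - xs))\<^sup>2 \<le> bregman g x xs"
    unfolding g_def by (rule shifted_bregman_bounds(1)[OF smooth])
  then show 1: "\<delta> * \<mu> / 2 * (norm (x - xs))\<^sup>2 \<le> bregman g x xs" by (simp add: algebra_simps)
  have "\<delta> * bregman f x xs = \<delta> * bregman g x xs + (1 - \<delta>) * (\<delta> * \<mu> / 2 * (norm (x - xs))\<^sup>2)"
    unfolding g_def bregman_shifted[OF differentiable] by (simp add: algebra_simps)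
  also have "\<dots> \<le> \<delta> * bregman g x xs + (1 - \<delta>) * bregman g x xs"
    using 1 \<delta> by (intro add_mono mult_left_mono) auto
  finally have "\<delta> * (\<delta> * bregman f x xs) \<le> \<delta> * bregman g x xs"
    using \<delta> by (intro mult_left_mono) (auto simp: algebra_simps)
  moreover have "inner (grad g x) (x - xs) - 2 * bregman g x xs = bregman_asym f x xs"
    unfolding g_def inner_grad_shifted bregman_asym_def bregman_shifted[OF differentiable]
    by (simp add: norm_minus_commute)
  ultimately show "\<bar>inner (grad g x) (x - xs) - 2 * bregman g x xs\<bar> \<le> \<delta> * bregman g x xs"
    using asym by (simp add: power2_eq_square mult.assoc)
qed

text \<open>The doubled rate. The cross term \<open>\<delta> \<mu> \<langle>x, y\<rangle>\<close> is split with weight \<open>\<surd>\<delta>\<close>, which balances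
  its two parts: each becomes \<open>\<surd>\<delta>\<close> times a term of the Lyapunov function.\<close>

lemma lyap_contracts_asym:
  assumes step: "hnag_step (x, y) (x', y')"
    and asym: "\<bar>bregman_asym f x' xs\<bar> \<le> \<delta>\<^sup>2 * bregman f x' xs" and \<delta>: "0 \<le> \<delta>" "\<delta> \<le> 1"
  defines "m \<equiv> (1 - \<delta>) * \<mu>"
  shows "(1 + (2 - sqrt \<delta> - \<delta>) * \<alpha>) * lyap \<mu> L f xs (x', y') m \<le> lyap \<mu> L f xs (x, y) m"
proof -
  let ?g = "shifted f xs m" and ?s = "sqrt \<delta>"
  let ?B = "bregman ?g x' xs" and ?I = "inner (x' - xs) (y' - xs)"
  let ?p = "norm (x' - xs)" and ?w = "norm (y' - xs)"
  have m: "0 \<le> m" "m \<le> \<mu>" using \<delta> \<mu>_pos by (simp_all add: m_def mult_le_cancel_right1)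
  have s: "0 \<le> ?s" "?s \<le> 1" "?s\<^sup>2 = \<delta>" using \<delta> by auto
  have "0 \<le> (norm (?s *\<^sub>R (x' - xs) - (y' - xs)))\<^sup>2" by simp
  also have "\<dots> = ?s\<^sup>2 * ?p\<^sup>2 + ?w\<^sup>2 - 2 * ?s * ?I"
    unfolding power2_norm_eq_inner power2_eq_square[of "sqrt \<delta>"]
    by (simp add: inner_simps inner_commute algebra_simps del: real_sqrt_mult_self)
  finally have "\<mu> / 2 * ?s * (2 * ?s * ?I) \<le> \<mu> / 2 * ?s * (\<delta> * ?p\<^sup>2 + ?w\<^sup>2)"
    using \<mu>_pos s by (intro mult_left_mono) auto
  also have "\<mu> / 2 * ?s * (2 * ?s * ?I) = \<mu> * \<delta> * ?I"
    using s(3) by (simp add: power2_eq_square)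
  also have "\<mu> / 2 * ?s * (\<delta> * ?p\<^sup>2 + ?w\<^sup>2) = ?s * (\<delta> * \<mu> / 2 * ?p\<^sup>2) + ?s * (\<mu> / 2 * ?w\<^sup>2)"
    by (simp add: algebra_simps)
  also have "\<dots> \<le> ?s * ?B + ?s * (\<mu> / 2 * ?w\<^sup>2)"
    using shifted_asym_bound(1)[OF asym \<delta>] s \<mu>_pos by (intro add_mono mult_left_mono) (auto simp: m_def)
  finally have cross: "\<mu> * \<delta> * ?I \<le> ?s * ?B + ?s * (\<mu> / 2 * ?w\<^sup>2)" .
  have "(2 - \<delta>) * ?B \<le> inner (grad ?g x') (x' - xs)"
    using shifted_asym_bound(2)[OF asym \<delta>, folded m_def] by (simp add: left_diff_distrib)
  moreover have "0 \<le> \<delta> * (\<mu> / 2 * ?w\<^sup>2)" using \<delta> \<mu>_pos by simp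
  moreover have "(\<mu> - m) * ?I = \<mu> * \<delta> * ?I" by (simp add: m_def algebra_simps)
  moreover have "(2 - ?s - \<delta>) * (?B + \<mu> / 2 * ?w\<^sup>2)
      = (2 - \<delta>) * ?B + \<mu> * ?w\<^sup>2 - (?s * ?B + ?s * (\<mu> / 2 * ?w\<^sup>2)) - \<delta> * (\<mu> / 2 * ?w\<^sup>2)"
    by (simp add: field_simps)
  ultimately have "(2 - ?s - \<delta>) * (?B + \<mu> / 2 * ?w\<^sup>2)
      \<le> inner (grad ?g x') (x' - xs) + \<mu> * ?w\<^sup>2 - (\<mu> - m) * ?I"
    using cross by linarith
  moreover have "(2 - ?s - \<delta>) * lyap \<mu> L f xs (x', y') m \<le> (2 - ?s - \<delta>) * (?B + \<mu> / 2 * ?w\<^sup>2)"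
    by (intro mult_left_mono lyap_le) (use s(2) \<delta>(2) in linarith)
  ultimately have "\<alpha> * ((2 - ?s - \<delta>) * lyap \<mu> L f xs (x', y') m)
      \<le> \<alpha> * (inner (grad ?g x') (x' - xs) + \<mu> * ?w\<^sup>2 - (\<mu> - m) * ?I)"
    using \<alpha>_pos by (intro mult_left_mono) auto
  then show ?thesis using lyap_step[OF step m] by (simp add: algebra_simps)
qed

text \<open>Increasing the shift by \<open>d\<close> can enlarge the Lyapunov function only through the subtracted
  gradient term, by at most \<open>d/L \<langle>\<nabla>g(x), x - x\<^sup>*\<rangle> \<le> 3 d/L D\<^sub>g(x, x\<^sup>*)\<close>. As the shift is at least
  \<open>\<mu>/2\<close>, the Lyapunov function dominates \<open>\<mu>/(2L) D\<^sub>g(x, x\<^sup>*)\<close>; this explains the factor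
  \<open>6 = 3 \<cdot> 2\<close>.\<close>

lemma lyap_shift_increment:
  assumes asym: "\<bar>bregman_asym f x xs\<bar> \<le> \<delta>'\<^sup>2 * bregman f x xs"
    and \<delta>: "0 \<le> \<delta>'" "\<delta>' \<le> \<delta>" "\<delta> \<le> 1 / 2"
  shows "(1 - 6 * (\<delta> - \<delta>')) * lyap \<mu> L f xs (x, y) ((1 - \<delta>') * \<mu>)
    \<le> lyap \<mu> L f xs (x, y) ((1 - \<delta>) * \<mu>)"
proof -
  define m m' d where "m = (1 - \<delta>) * \<mu>" and "m' = (1 - \<delta>') * \<mu>" and "d = (\<delta> - \<delta>') * \<mu>"
  have m: "m = m' - d" by (simp add: m_def m'_def d_def algebra_simps)
  let ?g = "shifted f xs m'"
  let ?B = "bregman ?g x xs" and ?E = "lyap \<mu> L f xs (x, y) m'" and ?p = "norm (x - xs)"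
  have d: "0 \<le> d" "d \<le> L" using \<delta> \<mu>_pos \<mu>_le_L
    by (auto simp: d_def intro: order_trans[OF mult_left_le_one_le])
  have m': "m' \<le> \<mu>" "\<mu> / 2 \<le> m'" using \<delta> \<mu>_pos by (auto simp: m'_def field_simps)
  have B0: "0 \<le> ?B" by (rule bregman_shifted_nonneg[OF m'(1)])
  have "grad (shifted f xs m) x = grad ?g x + d *\<^sub>R (x - xs)"
    by (simp add: grad_shifted[OF differentiable] m algebra_simps)
  then have "(norm (grad (shifted f xs m) x))\<^sup>2
      = (norm (grad ?g x))\<^sup>2 + 2 * d * inner (grad ?g x) (x - xs) + d\<^sup>2 * ?p\<^sup>2"
    by (simp add: norm_sq_add_scaled)
  then have "?E - lyap \<mu> L f xs (x, y) m
      = d / L * inner (grad ?g x) (x - xs) + (d\<^sup>2 / (2 * L) - d / 2) * ?p\<^sup>2"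
    unfolding lyap_eq bregman_shifted[OF differentiable] using L_pos by (simp add: m field_simps)
  also have "\<dots> \<le> d / L * inner (grad ?g x) (x - xs)"
  proof -
    have "d * d \<le> d * L" using d by (intro mult_left_mono) auto
    then have "d\<^sup>2 / (2 * L) - d / 2 \<le> 0" using L_pos by (simp add: field_simps power2_eq_square)
    then show ?thesis by (simp add: mult_nonpos_nonneg)
  qed
  also have "\<dots> \<le> d / L * (3 * ?B)"
  proof -
    have "\<delta>' * ?B \<le> 1 * ?B" using B0 \<delta> by (intro mult_right_mono) auto
    then have "inner (grad ?g x) (x - xs) \<le> 3 * ?B"
      using shifted_asym_bound(2)[OF asym \<delta>(1)] \<delta> by (simp add: m'_def)
    then show ?thesis using d L_pos by (intro mult_left_mono) auto
  qed
  also have "\<dots> = 6 * (\<delta> - \<delta>') * (\<mu> / 2 / L * ?B)" using L_pos by (simp add: d_def field_simps)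
  also have "\<dots> \<le> 6 * (\<delta> - \<delta>') * ?E"
  proof -
    have "\<mu> / 2 / L * ?B \<le> m' / L * ?B"
      using m' B0 L_pos by (intro mult_right_mono divide_right_mono) auto
    also have "\<dots> \<le> m' / L * ?B + \<mu> / 2 * (norm (y - xs))\<^sup>2" using \<mu>_pos by simp
    also have "\<dots> \<le> ?E" by (rule lyap_lower_bound[OF m'(1)])
    finally show ?thesis using \<delta> by (intro mult_left_mono) auto
  qed
  finally show ?thesis by (simp add: m_def m'_def algebra_simps)
qed

lemma hnag_pp_step:
  assumes "hnag_pp \<mu> L f x v y"
  shows "hnag_step (x k, y k) (x (Suc k), y (Suc k))"
proof -
  have v: "v (Suc j) = (1 / (1 + \<alpha>)) *\<^sub>R (v j + \<alpha>\<^sup>2 *\<^sub>R x j - (2 / L) *\<^sub>R grad f (x j))"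
    and x: "x (Suc j) = (1 / (1 + \<alpha>)) *\<^sub>R (x j + v (Suc j) - (1 / L) *\<^sub>R grad f (x j))"
    and y: "y j = (1 / \<alpha>) *\<^sub>R v (Suc j)" for j
    using assms by (simp_all add: hnag_pp_def Let_def flip: \<alpha>_def)
  have vy: "v (Suc j) = \<alpha> *\<^sub>R y j" for j using y[of j] \<alpha>_pos by simp
  have x': "(1 + \<alpha>) *\<^sub>R x (Suc k) = x k + \<alpha> *\<^sub>R y k - (1 / L) *\<^sub>R grad f (x k)"
    using \<alpha>_pos by (subst x) (simp add: vy)
  have "2 / L = \<alpha> * (\<alpha> / \<mu>)"
    using \<alpha>_sq \<mu>_pos by (simp add: power2_eq_square)
  have "\<alpha> *\<^sub>R ((1 + \<alpha>) *\<^sub>R y (Suc k)) = (1 + \<alpha>) *\<^sub>R v (Suc (Suc k))"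
    by (simp add: vy mult.commute)
  also have "\<dots> = v (Suc k) + \<alpha>\<^sup>2 *\<^sub>R x (Suc k) - (2 / L) *\<^sub>R grad f (x (Suc k))"
    using \<alpha>_pos by (subst v) simp
  also have "\<dots> = \<alpha> *\<^sub>R (y k + \<alpha> *\<^sub>R x (Suc k) - (\<alpha> / \<mu>) *\<^sub>R grad f (x (Suc k)))"
    unfolding vy \<open>2 / L = _\<close> power2_eq_square scaleR_diff_right scaleR_add_right scaleR_scaleR ..
  finally have "\<alpha> *\<^sub>R ((1 + \<alpha>) *\<^sub>R y (Suc k))
      = \<alpha> *\<^sub>R (y k + \<alpha> *\<^sub>R x (Suc k) - (\<alpha> / \<mu>) *\<^sub>R grad f (x (Suc k)))" .
  then have "(1 + \<alpha>) *\<^sub>R y (Suc k) = y k + \<alpha> *\<^sub>R x (Suc k) - (\<alpha> / \<mu>) *\<^sub>R grad f (x (Suc k))"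
    using \<alpha>_pos by (subst (asm) scaleR_cancel_left) auto
  with x' show ?thesis by (simp add: hnag_step_def)
qed

text \<open>The shift \<open>\<mu>/2\<close> is strictly between \<open>0\<close> and \<open>\<mu>\<close>: the shifted function is then still
  strongly convex, and the Lyapunov function keeps a positive fraction of its divergence.\<close>

lemma hnag_iterates_tendsto:
  assumes step: "\<And>k. hnag_step (x k, y k) (x (Suc k), y (Suc k))"
  shows "x \<longlonglongrightarrow> xs"
proof -
  let ?E = "\<lambda>k. lyap \<mu> L f xs (x k, y k) (\<mu> / 2)"
  define q where "q = inverse (1 + \<alpha>)"
  have q: "0 < q" "q < 1" using \<alpha>_pos by (auto simp: q_def field_simps)
  have "?E (Suc k) \<le> q * ?E k" for k
    using lyap_contracts[OF step, of "\<mu> / 2" k] \<mu>_pos \<alpha>_pos by (simp add: q_def field_simps)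
  then have E: "?E k \<le> q ^ k * ?E 0" for k
  proof (induction k)
    case (Suc k)
    then show ?case using q by (auto intro: order_trans[OF Suc.prems] simp: mult.assoc)
  qed simp
  define c where "c = \<mu> / 2 / L * (\<mu> / 4)"
  have c: "0 < c" using \<mu>_pos L_pos by (simp add: c_def)
  have "(norm (x k - xs))\<^sup>2 \<le> q ^ k * (?E 0 / c)" for k
  proof -
    have "(\<mu> - \<mu> / 2) / 2 * (norm (x k - xs))\<^sup>2 \<le> bregman (shifted f xs (\<mu> / 2)) (x k) xs"
      by (rule shifted_bregman_bounds(1)[OF smooth])
    then have "\<mu> / 2 / L * (\<mu> / 4 * (norm (x k - xs))\<^sup>2)
        \<le> \<mu> / 2 / L * bregman (shifted f xs (\<mu> / 2)) (x k) xs"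
      using \<mu>_pos L_pos by (intro mult_left_mono) auto
    also have "\<dots> \<le> \<mu> / 2 / L * bregman (shifted f xs (\<mu> / 2)) (x k) xs + \<mu> / 2 * (norm (y k - xs))\<^sup>2"
      using \<mu>_pos by simp
    also have "\<dots> \<le> ?E k" using \<mu>_pos by (intro lyap_lower_bound) auto
    finally have "c * (norm (x k - xs))\<^sup>2 \<le> q ^ k * ?E 0"
      using E[of k] unfolding c_def mult.assoc by linarith
    then show ?thesis using c by (simp add: field_simps)
  qed
  moreover have "(\<lambda>k. q ^ k * (?E 0 / c)) \<longlonglongrightarrow> 0"
    using q by (intro tendsto_mult_left_zero LIMSEQ_power_zero) auto
  ultimately have "(\<lambda>k. (norm (x k - xs))\<^sup>2) \<longlonglongrightarrow> 0"
    by (intro tendsto_sandwich[of "\<lambda>_. 0" "\<lambda>k. (norm (x k - xs))\<^sup>2" sequentially "\<lambda>k. q ^ k * (?E 0 / c)" 0])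
      (auto intro: always_eventually)
  then have "(\<lambda>k. sqrt ((norm (x k - xs))\<^sup>2)) \<longlonglongrightarrow> sqrt 0" by (rule tendsto_real_sqrt)
  then show ?thesis by (simp add: tendsto_norm_zero_iff LIM_zero_iff)
qed

lemma lyap_init_nonneg: "0 \<le> lyap_init \<mu> L f xs x0 y0"
proof -
  have "shifted f xs 0 = f" by (simp add: shifted_def)
  then have "lyap_init \<mu> L f xs x0 y0 = lyap \<mu> L f xs (x0, y0) 0"
    by (simp add: lyap_init_def lyap_def bregman_def grad_xs)
  then show ?thesis using lyap_nonneg[of 0 x0 y0] \<mu>_pos by simp
qed

end

section \<open>Asymmetry modulus and convergence rates of sequences\<close>

lemma asym_modulus_le:
  fixes f :: "'a::euclidean_space \<Rightarrow> real"
  assumes "0 \<le> R" "0 \<le> e"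
    and bound: "\<And>x. x \<noteq> xs \<Longrightarrow> norm (x - xs) \<le> R \<Longrightarrow> \<bar>bregman_asym f x xs\<bar> / bregman f x xs \<le> e"
  shows "asym_modulus f xs R \<le> e"
proof (cases "R = 0")
  case True
  then show ?thesis using assms by (simp add: asym_modulus_def)
next
  case False
  obtain b :: 'a where "b \<in> Basis" using nonempty_Basis by blast
  then have "xs + R *\<^sub>R b \<in> {x. 0 < norm (x - xs) \<and> norm (x - xs) \<le> R}"
    using False \<open>0 \<le> R\<close> by (auto simp: nonzero_Basis)
  then have "{x. 0 < norm (x - xs) \<and> norm (x - xs) \<le> R} \<noteq> {}" by blast
  then have "(SUP x\<in>{x. 0 < norm (x - xs) \<and> norm (x - xs) \<le> R}. \<bar>bregman_asym f x xs\<bar> / bregman f x xs) \<le> e"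
    by (rule cSUP_least) (auto intro: bound)
  then show ?thesis using False by (simp add: asym_modulus_def)
qed

lemma asym_modulus_eventually_le:
  fixes f :: "'a::euclidean_space \<Rightarrow> real"
  assumes lim: "((\<lambda>x. \<bar>bregman_asym f x xs\<bar> / bregman f x xs) \<longlongrightarrow> 0) (at xs)"
    and R: "\<And>k. 0 \<le> R k" "R \<longlonglongrightarrow> 0" and "0 < e"
  shows "\<forall>\<^sub>F k in sequentially. asym_modulus f xs (R k) \<le> e"
proof -
  have "\<forall>\<^sub>F x in at xs. \<bar>bregman_asym f x xs\<bar> / bregman f x xs < e"
    using order_tendstoD(2)[OF lim \<open>0 < e\<close>] .
  then obtain d where d: "0 < d"
    and small: "\<And>x. x \<noteq> xs \<Longrightarrow> dist x xs < d \<Longrightarrow> \<bar>bregman_asym f x xs\<bar> / bregman f x xs < e"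
    unfolding eventually_at by blast
  from order_tendstoD(2)[OF R(2) d] show ?thesis
  proof eventually_elim
    case (elim k)
    show ?case
    proof (rule asym_modulus_le)
      fix x assume "x \<noteq> xs" "norm (x - xs) \<le> R k"
      then show "\<bar>bregman_asym f x xs\<bar> / bregman f x xs \<le> e"
        using small[of x] elim by (simp add: dist_norm)
    qed (use R \<open>0 < e\<close> in auto)
  qed
qed

lemma ex_decseq_majorant:
  fixes a :: "nat \<Rightarrow> real"
  assumes "a \<longlonglongrightarrow> 0"
  shows "\<exists>d. decseq d \<and> d \<longlonglongrightarrow> 0 \<and> (\<forall>k. \<bar>a k\<bar> \<le> d k)"
proof -
  have "bounded (range a)" using assms by (intro convergent_imp_bounded)
  then have "bdd_above (range (\<lambda>j. \<bar>a j\<bar>))"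
    by (auto simp: bounded_iff bdd_above_def)
  then have bdd: "bdd_above ((\<lambda>j. \<bar>a j\<bar>) ` S)" for S
    by (rule bdd_above_mono) auto
  define d where "d k = (SUP j\<in>{k..}. \<bar>a j\<bar>)" for k
  have maj: "\<bar>a k\<bar> \<le> d k" for k
    unfolding d_def by (intro cSUP_upper bdd) auto
  moreover have "decseq d"
    unfolding decseq_def d_def by (intro allI impI cSUP_subset_mono bdd) auto
  moreover have "d \<longlonglongrightarrow> 0"
  proof (rule LIMSEQ_I)
    fix e :: real assume "0 < e"
    then obtain N where N: "\<And>j. j \<ge> N \<Longrightarrow> \<bar>a j\<bar> < e / 2"
      using LIMSEQ_D[OF assms, of "e / 2"] by auto
    have "norm (d k - 0) < e" if "N \<le> k" for k
    proof -
      have "d k \<le> e / 2"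
        unfolding d_def
      proof (rule cSUP_least)
        fix j assume "j \<in> {k..}"
        then show "\<bar>a j\<bar> \<le> e / 2" using that N[of j] by simp
      qed simp
      moreover have "0 \<le> d k" using maj[of k] by linarith
      ultimately show ?thesis using \<open>0 < e\<close> by simp
    qed
    then show "\<exists>N. \<forall>k\<ge>N. norm (d k - 0) < e" by blast
  qed
  ultimately show ?thesis by blast
qed

text \<open>The quotient of \<open>E (Suc k)\<close> by the product is nonincreasing from \<open>N\<close> on, so its maximum over
  the initial indices bounds it everywhere.\<close>

lemma prod_bound_of_eventual_contraction:
  fixes E r :: "nat \<Rightarrow> real"
  assumes r: "\<And>k. 0 < r k" and ev: "\<And>k. N \<le> k \<Longrightarrow> E (Suc k) \<le> r k * E k"
  shows "\<exists>C>0. \<forall>k. E (Suc k) \<le> C * (\<Prod>i=0..k. r i)"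
proof -
  let ?P = "\<lambda>k. \<Prod>i=0..k. r i"
  have P: "0 < ?P k" for k using r by (intro prod_pos) auto
  define C where "C = Max (insert 1 ((\<lambda>k. E (Suc k) / ?P k) ` {..N}))"
  have C1: "1 \<le> C" unfolding C_def by (rule Max_ge) auto
  have init: "E (Suc k) \<le> C * ?P k" if "k \<le> N" for k
  proof -
    have "E (Suc k) / ?P k \<le> C" unfolding C_def using that by (intro Max_ge) auto
    then show ?thesis using P[of k] by (simp add: field_simps)
  qed
  have "E (Suc k) \<le> C * ?P k" for k
  proof (cases "k \<le> N")
    case False
    then have "N \<le> k" by simp
    then show ?thesis
    proof (induction k rule: dec_induct)
      case (step k)
      have "E (Suc (Suc k)) \<le> r (Suc k) * E (Suc k)" using step.hyps by (intro ev) simp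
      also have "\<dots> \<le> r (Suc k) * (C * ?P k)" 
        by (rule mult_left_mono[OF step.IH less_imp_le[OF r]])
      finally show ?case by (simp add: mult_ac)
    qed (rule init, simp)
  qed (rule init)
  then show ?thesis using C1 by (intro exI[of _ C]) auto
qed

text \<open>For every \<open>q > \<rho>\<close> the sequence is eventually dominated by a multiple of \<open>q ^ k\<close>, and the
  \<open>k\<close>-th root of the constant tends to \<open>1\<close>.\<close>

lemma R_linear_of_ratio_limit:
  fixes E G r :: "nat \<Rightarrow> real"
  assumes E: "\<And>k. 0 \<le> E k" and ev: "\<forall>\<^sub>F k in sequentially. E (Suc k) \<le> r k * E k"
    and lim: "r \<longlonglongrightarrow> \<rho>" and "0 \<le> \<rho>"
    and G: "\<And>k. 0 \<le> G k" "\<And>k. G k \<le> M * E k" and "0 \<le> M"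
  shows "R_linear G \<rho>"
proof -
  have "limsup (\<lambda>k. ereal (root k (G k))) \<le> ereal \<rho> + ereal e" if "0 < e" for e
  proof -
    define q where "q = \<rho> + e"
    have q: "0 < q" using that \<open>0 \<le> \<rho>\<close> by (simp add: q_def)
    have "\<forall>\<^sub>F k in sequentially. r k < q"
      using that by (intro order_tendstoD(2)[OF lim]) (simp add: q_def)
    with ev have "\<forall>\<^sub>F k in sequentially. E (Suc k) \<le> q * E k"
    proof eventually_elim
      case (elim k)
      have "r k * E k \<le> q * E k" using elim E by (intro mult_right_mono) auto
      with elim show ?case by linarith
    qed
    then obtain N where N: "\<And>k. N \<le> k \<Longrightarrow> E (Suc k) \<le> q * E k"
      unfolding eventually_sequentially by blast
    obtain C where "0 < C" and C: "\<And>k. E (Suc k) \<le> C * (\<Prod>i=0..k. q)"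
      using prod_bound_of_eventual_contraction[of "\<lambda>_. q" N E] q N by blast
    \<comment> \<open>the summand 1 keeps the constant positive when \<open>M = 0\<close>, so that its roots tend to 1\<close>
    have GC: "G k \<le> (M * C + 1) * q ^ k" if "0 < k" for k
    proof -
      obtain j where k: "k = Suc j" using \<open>0 < k\<close> by (cases k) auto
      have "G k \<le> M * E k" by (rule G)
      also have "\<dots> \<le> M * (C * q ^ k)"
        using C[of j] \<open>0 \<le> M\<close> by (intro mult_left_mono) (auto simp: k)
      also have "\<dots> \<le> (M * C + 1) * q ^ k" using q by (simp add: algebra_simps)
      finally show ?thesis .
    qed
    have A: "0 < M * C + 1" using \<open>0 \<le> M\<close> \<open>0 < C\<close> by (simp add: add_nonneg_pos)
    have "\<forall>\<^sub>F k in sequentially. ereal (root k (G k)) \<le> ereal (root k (M * C + 1) * q)"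
      using eventually_gt_at_top[of 0]
    proof eventually_elim
      case (elim k)
      have "root k (G k) \<le> root k ((M * C + 1) * q ^ k)" using elim GC by simp
      also have "\<dots> = root k (M * C + 1) * q"
        using elim q by (simp add: real_root_mult real_root_power_cancel)
      finally show ?case by simp
    qed
    then have "limsup (\<lambda>k. ereal (root k (G k))) \<le> limsup (\<lambda>k. ereal (root k (M * C + 1) * q))"
      by (rule Limsup_mono)
    also have "(\<lambda>k. root k (M * C + 1) * q) \<longlonglongrightarrow> 1 * q"
      by (intro tendsto_intros LIMSEQ_root_const A)
    then have "limsup (\<lambda>k. ereal (root k (M * C + 1) * q)) = ereal q"
      by (intro lim_imp_Limsup) auto
    finally show ?thesis by (simp add: q_def)
  qed
  then have "limsup (\<lambda>k. ereal (root k (G k))) \<le> ereal \<rho>"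
    by (rule ereal_le_epsilon2)
  then show ?thesis using G(1) by (simp add: R_linear_def)
qed

lemma rate_expansion:
  "(\<lambda>t::real. 1 / (1 + 2 * sqrt (2 / t)) - (1 - 2 * sqrt (2 / t))) \<in> O[at_top](\<lambda>t. 1 / t)"
proof (rule bigoI[of _ 8])
  show "\<forall>\<^sub>F t in at_top. norm (1 / (1 + 2 * sqrt (2 / t)) - (1 - 2 * sqrt (2 / t))) \<le> 8 * norm (1 / t :: real)"
    using eventually_gt_at_top[of 0]
  proof eventually_elim
    case (elim t)
    define s where "s = 2 * sqrt (2 / t)"
    have s: "0 \<le> s" "s\<^sup>2 = 8 / t" using elim by (auto simp: s_def power_mult_distrib)
    have "1 / (1 + s) - (1 - s) = s\<^sup>2 / (1 + s)"
      using s(1) by (simp add: field_simps power2_eq_square)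
    moreover have "s\<^sup>2 / (1 + s) \<le> s\<^sup>2" using s(1) by (simp add: field_simps)
    moreover have "0 \<le> s\<^sup>2 / (1 + s)" using s(1) by simp
    ultimately have "norm (1 / (1 + s) - (1 - s)) \<le> 8 / t" using s(2) by simp
    then show ?case using elim by (simp add: s_def)
  qed
qed

section \<open>Accelerated convergence of HNAG++\<close>

theorem theorem5p2:
  fixes f :: "'a::euclidean_space \<Rightarrow> real"
    and x v y :: "nat \<Rightarrow> 'a"
    and xs :: 'a
    and \<mu> L \<kappa> \<alpha> :: real
    and \<omega> :: "nat \<Rightarrow> real"
    and K :: nat
  assumes "0 < \<mu>" and "\<mu> \<le> L"
    and "\<kappa> = L / \<mu>"
    and "\<alpha> = hnag_alpha \<mu> L"
    and "LAS \<mu> L xs f"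
    and "hnag_pp \<mu> L f x v y"
    and "\<omega> = hnag_omega \<mu> L f xs (x 0) (y 0)"
    and "K = (LEAST k. \<omega> k \<le> 1 / 8)"
  shows "(\<exists>k. \<omega> k \<le> 1 / 8) \<and>
    (\<exists>(\<mu>s :: nat \<Rightarrow> real) (\<delta> :: nat \<Rightarrow> real) (b :: nat \<Rightarrow> real) (c :: nat \<Rightarrow> real) (C :: real).
      (\<forall>k. 0 \<le> \<mu>s k \<and> 0 \<le> \<delta> k \<and> 0 \<le> b k \<and> 0 \<le> c k) \<and> 0 < C \<and>
      (\<forall>k. \<mu>s k = (1 - \<delta> k) * \<mu>) \<and>
      decseq \<delta> \<and> \<delta> \<longlonglongrightarrow> 0 \<and>
      b \<longlonglongrightarrow> 0 \<and>
      (\<forall>k. c k = 2 - sqrt (\<delta> k) - b k) \<and> c \<longlonglongrightarrow> 2 \<and>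
      (\<forall>k. \<mu> / 2 * (norm (y (Suc k) - xs))\<^sup>2
              \<le> lyap \<mu> L f xs (x (Suc k), y (Suc k)) (\<mu>s (Suc k)) \<and>
           lyap \<mu> L f xs (x (Suc k), y (Suc k)) (\<mu>s (Suc k))
              \<le> C * (\<Prod>i=0..k. hnag_rate \<alpha> K c \<delta> i)) \<and>
      R_linear (\<lambda>k. lyap \<mu> L f xs (x k, y k) (\<mu>s k)) (1 / (1 + 2 * sqrt (2 / \<kappa>))) \<and>
      R_linear (\<lambda>k. (norm (y k - xs))\<^sup>2) (1 / (1 + 2 * sqrt (2 / \<kappa>)))) \<and>
    (\<lambda>t::real. 1 / (1 + 2 * sqrt (2 / t)) - (1 - 2 * sqrt (2 / t))) \<in> O[at_top](\<lambda>t. 1 / t)"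
proof -
  have sm: "sc_smooth \<mu> L f" and minim: "\<And>x. f xs \<le> f x"
    and las: "((\<lambda>x. \<bar>bregman_asym f x xs\<bar> / bregman f x xs) \<longlongrightarrow> 0) (at xs)"
    using assms(5) by (auto simp: LAS_def)
  interpret smooth_minimization \<mu> L \<alpha> f xs
    by unfold_locales (fact assms(1) assms(2) assms(4) sm minim)+
  have step: "hnag_step (x k, y k) (x (Suc k), y (Suc k))" for k
    by (rule hnag_pp_step[OF assms(6)])
  have rate: "1 / (1 + 2 * sqrt (2 / \<kappa>)) = inverse (1 + 2 * \<alpha>)"
    using assms(1,2) by (simp add: assms(3,4) hnag_alpha_def inverse_eq_divide)

  have "\<exists>k. \<omega> k \<le> 1 / 8"
  proof -
    define R where "R k = hnag_C1 \<mu> L f xs (x 0) (y 0) * (1 + \<alpha>) powr (- (real k + 1) / 2)" for k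
    have "0 \<le> hnag_C1 \<mu> L f xs (x 0) (y 0)"
      using lyap_init_nonneg[of "x 0" "y 0"] \<alpha>_pos \<mu>_pos
      by (simp add: hnag_C1_def Let_def flip: \<alpha>_def)
    then have R0: "0 \<le> R k" for k by (simp add: R_def)
    define q where "q = (1 + \<alpha>) powr (- 1 / 2)"
    have q: "0 < q" "q < 1" using \<alpha>_pos by (auto simp: q_def powr_less_one)
    have "(1 + \<alpha>) powr (- (real k + 1) / 2) = q ^ Suc k" for k
    proof -
      have "- (real k + 1) / 2 = - 1 / 2 * real (Suc k)" by (simp add: field_simps)
      then have "(1 + \<alpha>) powr (- (real k + 1) / 2) = q powr real (Suc k)"
        unfolding q_def powr_powr by (rule arg_cong)
      then show ?thesis using powr_realpow[OF q(1), of "Suc k"] by simp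
    qed
    moreover have "(\<lambda>k. q ^ Suc k) \<longlonglongrightarrow> 0"
      using q by (intro LIMSEQ_Suc LIMSEQ_power_zero) auto
    ultimately have "(\<lambda>k. (1 + \<alpha>) powr (- (real k + 1) / 2)) \<longlonglongrightarrow> 0" by simp
    then have "R \<longlonglongrightarrow> 0" unfolding R_def by (rule tendsto_mult_right_zero)
    then have "\<forall>\<^sub>F k in sequentially. asym_modulus f xs (R k) \<le> 1 / 8"
      by (intro asym_modulus_eventually_le las R0) auto
    moreover have "\<omega> k = asym_modulus f xs (R k)" for k
      by (simp add: assms(7) hnag_omega_def R_def Let_def \<alpha>_def hnag_alpha_def)
    ultimately show ?thesis by (auto simp: eventually_sequentially)
  qed

  moreover have "\<exists>(\<mu>s :: nat \<Rightarrow> real) (\<delta> :: nat \<Rightarrow> real) (b :: nat \<Rightarrow> real) (c :: nat \<Rightarrow> real) (C :: real).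
      (\<forall>k. 0 \<le> \<mu>s k \<and> 0 \<le> \<delta> k \<and> 0 \<le> b k \<and> 0 \<le> c k) \<and> 0 < C \<and>
      (\<forall>k. \<mu>s k = (1 - \<delta> k) * \<mu>) \<and>
      decseq \<delta> \<and> \<delta> \<longlonglongrightarrow> 0 \<and>
      b \<longlonglongrightarrow> 0 \<and>
      (\<forall>k. c k = 2 - sqrt (\<delta> k) - b k) \<and> c \<longlonglongrightarrow> 2 \<and>
      (\<forall>k. \<mu> / 2 * (norm (y (Suc k) - xs))\<^sup>2
              \<le> lyap \<mu> L f xs (x (Suc k), y (Suc k)) (\<mu>s (Suc k)) \<and>
           lyap \<mu> L f xs (x (Suc k), y (Suc k)) (\<mu>s (Suc k))
              \<le> C * (\<Prod>i=0..k. hnag_rate \<alpha> K c \<delta> i)) \<and>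
      R_linear (\<lambda>k. lyap \<mu> L f xs (x k, y k) (\<mu>s k)) (1 / (1 + 2 * sqrt (2 / \<kappa>))) \<and>
      R_linear (\<lambda>k. (norm (y k - xs))\<^sup>2) (1 / (1 + 2 * sqrt (2 / \<kappa>)))"
  proof -
    have x_lim: "x \<longlonglongrightarrow> xs"
      by (rule hnag_iterates_tendsto[of x y]) (rule step)
    \<comment> \<open>At the minimizer \<open>h\<close> is \<open>0 / 0 = 0\<close>, which is its limit there; so iterates that hit the minimizer need no separate treatment in the limit.\<close>
    define h where "h z = \<bar>bregman_asym f z xs\<bar> / bregman f z xs" for z
    have hxs: "h xs = 0" by (simp add: h_def bregman_asym_def)
    have "isCont h xs" unfolding isCont_def hxs using las by (simp add: h_def[abs_def])
    then have "(\<lambda>k. h (x k)) \<longlonglongrightarrow> 0"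
      using isCont_tendsto_compose[OF _ x_lim, of h] hxs by simp
    then have "(\<lambda>k. sqrt (h (x k))) \<longlonglongrightarrow> sqrt 0" by (rule tendsto_real_sqrt)
    then obtain d where "decseq d" and d0: "d \<longlonglongrightarrow> 0" and hd: "\<And>k. \<bar>sqrt (h (x k))\<bar> \<le> d k"
      using ex_decseq_majorant[of "\<lambda>k. sqrt (h (x k))"] by auto
    have d_nonneg: "0 \<le> d k" for k using hd[of k] by linarith
    have asym: "\<bar>bregman_asym f (x k) xs\<bar> \<le> \<delta>\<^sup>2 * bregman f (x k) xs" if "d k \<le> \<delta>" for k \<delta>
    proof (cases "x k = xs")
      case False
      have "0 < \<mu> / 2 * (norm (x k - xs))\<^sup>2" using False \<mu>_pos by simp
      also have "\<dots> \<le> bregman f (x k) xs" using sm by (simp add: sc_smooth_def)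
      finally have pos: "0 < bregman f (x k) xs" .
      then have "0 \<le> h (x k)" by (simp add: h_def)
      then have "h (x k) = \<bar>sqrt (h (x k))\<bar>\<^sup>2" by simp
      also have "\<dots> \<le> \<delta>\<^sup>2" using hd[of k] that by (intro power_mono) auto
      finally show ?thesis using pos by (simp add: h_def pos_divide_le_eq)
    qed (simp add: bregman_asym_def bregman_def)

    \<comment> \<open>chosen such that \<open>\<gamma> \<alpha> = 6 (1 + 2 \<alpha>)\<close>: the loss factor \<open>1 - 6 (\<delta> k - \<delta> (Suc k))\<close> of
      changing the shift, multiplied by a rate denominator of at most \<open>1 + 2 \<alpha>\<close>, is paid by a
      decrease of the coefficient of \<open>\<alpha>\<close>\<close>
    define \<gamma> where "\<gamma> = 6 * (1 + 2 * \<alpha>) / \<alpha>"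
    have \<gamma>: "0 < \<gamma>" "\<gamma> * \<alpha> = 6 * (1 + 2 * \<alpha>)" using \<alpha>_pos by (simp_all add: \<gamma>_def)
    have "(\<lambda>k. sqrt (d k) + d k + \<gamma> * d k) \<longlonglongrightarrow> sqrt 0 + 0 + \<gamma> * 0"
      by (intro tendsto_intros d0)
    then have "(\<lambda>k. sqrt (d k) + d k + \<gamma> * d k) \<longlonglongrightarrow> 0" by simp
    then have "\<forall>\<^sub>F k in sequentially. sqrt (d k) + d k + \<gamma> * d k < 1 \<and> d k < 1 / 2"
      using d0 by (intro eventually_conj order_tendstoD(2)) auto
    then obtain N where N: "sqrt (d N) + d N + \<gamma> * d N < 1" "d N < 1 / 2"
      by (auto simp: eventually_sequentially)

    \<comment> \<open>Freezing \<open>\<delta>\<close> before \<open>N\<close> keeps \<open>c k \<ge> 1\<close> for all \<open>k\<close>, so that every denominator in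
      the rates is positive.\<close>
    define \<delta> where "\<delta> k = d (max k N)" for k
    define b where "b k = \<delta> k + \<gamma> * (\<delta> k - \<delta> (Suc k))" for k
    define c where "c k = 2 - sqrt (\<delta> k) - b k" for k
    define \<mu>s where "\<mu>s k = (1 - \<delta> k) * \<mu>" for k
    define E where "E k = lyap \<mu> L f xs (x k, y k) (\<mu>s k)" for k
    define r where "r = hnag_rate \<alpha> K c \<delta>"

    have "decseq \<delta>" unfolding \<delta>_def decseq_def
      using \<open>decseq d\<close> by (auto simp: decseq_def)
    have "\<delta> \<longlonglongrightarrow> 0"
    proof (rule Lim_transform_eventually[OF d0])
      show "\<forall>\<^sub>F k in sequentially. d k = \<delta> k"
        using eventually_ge_at_top[of N] by eventually_elim (simp add: \<delta>_def)
    qed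
    have \<delta>_nonneg: "0 \<le> \<delta> k" for k by (simp add: \<delta>_def d_nonneg)
    have \<delta>_le: "\<delta> k \<le> d N" for k using \<open>decseq d\<close> by (simp add: \<delta>_def decseq_def)
    have \<delta>_Suc: "\<delta> (Suc k) \<le> \<delta> k" for k using \<open>decseq \<delta>\<close> by (simp add: decseq_def)
    have \<delta>_half: "\<delta> k < 1 / 2" for k using \<delta>_le[of k] N by linarith
    have \<mu>s: "0 \<le> \<mu>s k" "\<mu>s k \<le> \<mu>" for k
      using \<delta>_nonneg[of k] \<delta>_half[of k] \<mu>_pos by (auto simp: \<mu>s_def mult_le_cancel_right1)
    have b_nonneg: "0 \<le> b k" for k using \<delta>_nonneg[of k] \<delta>_Suc[of k] \<gamma> by (simp add: b_def)
    have c_ge: "1 \<le> c k" for k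
    proof -
      have "\<gamma> * (\<delta> k - \<delta> (Suc k)) \<le> \<gamma> * d N"
        using \<gamma> \<delta>_nonneg[of "Suc k"] \<delta>_le[of k] by (intro mult_left_mono) auto
      moreover have "sqrt (\<delta> k) \<le> sqrt (d N)" using \<delta>_le by simp
      ultimately show ?thesis using N \<delta>_le[of k] unfolding c_def b_def by linarith
    qed
    have \<Delta>_lim: "(\<lambda>k. \<delta> k - \<delta> (Suc k)) \<longlonglongrightarrow> 0"
      using tendsto_diff[OF \<open>\<delta> \<longlonglongrightarrow> 0\<close> LIMSEQ_Suc[OF \<open>\<delta> \<longlonglongrightarrow> 0\<close>]] by simp
    have b_lim: "b \<longlonglongrightarrow> 0"
      using tendsto_add[OF \<open>\<delta> \<longlonglongrightarrow> 0\<close> tendsto_mult_right_zero[OF \<Delta>_lim, of \<gamma>]]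
      by (simp add: b_def[abs_def])
    have c_lim: "c \<longlonglongrightarrow> 2"
    proof -
      have "c \<longlonglongrightarrow> 2 - sqrt 0 - 0"
        unfolding c_def by (intro tendsto_intros \<open>\<delta> \<longlonglongrightarrow> 0\<close> b_lim)
      then show ?thesis by simp
    qed

    have \<alpha>2: "\<alpha>\<^sup>2 \<le> 2" using \<mu>_le_L L_pos by (simp add: \<alpha>_sq pos_divide_le_eq)
    have den: "0 < 1 + c k * \<alpha> - (\<delta> k - \<delta> (Suc k)) * \<alpha>\<^sup>2" for k
    proof -
      have "(\<delta> k - \<delta> (Suc k)) * \<alpha>\<^sup>2 \<le> 1 / 2 * 2"
        using \<alpha>2 \<delta>_half[of k] \<delta>_nonneg[of "Suc k"] \<delta>_Suc[of k] by (intro mult_mono) auto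
      moreover have "0 < c k * \<alpha>" using c_ge[of k] \<alpha>_pos by (intro mult_pos_pos) auto
      ultimately show ?thesis by simp
    qed
    have r_pos: "0 < r k" for k
      using den[of k] \<alpha>_pos by (simp add: r_def hnag_rate_def)
    have E_nonneg: "0 \<le> E k" for k unfolding E_def by (intro lyap_nonneg \<mu>s)
    have E_step: "E (Suc k) \<le> r k * E k" if k: "max K N \<le> k" for k
    proof -
      define D where "D = \<delta> k - \<delta> (Suc k)"
      let ?c0 = "2 - sqrt (\<delta> k) - \<delta> k"
      have D: "0 \<le> D" using \<delta>_Suc[of k] by (simp add: D_def)
      have "0 \<le> sqrt (\<delta> k)" using \<delta>_nonneg by simp
      moreover have "1 \<le> ?c0 - \<gamma> * D" using c_ge[of k] by (simp add: c_def b_def D_def)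
      moreover have "0 \<le> \<gamma> * D" using \<gamma> D by simp
      ultimately have c0: "0 \<le> ?c0" "?c0 \<le> 2" using \<delta>_nonneg[of k] by linarith+
      have "\<delta> (Suc k) = d (Suc k)" using k by (simp add: \<delta>_def max.absorb1)
      then have dk: "d (Suc k) \<le> \<delta> (Suc k)" "d (Suc k) \<le> \<delta> k" using \<delta>_Suc[of k] by auto
      have 1: "(1 + ?c0 * \<alpha>) * lyap \<mu> L f xs (x (Suc k), y (Suc k)) (\<mu>s k) \<le> E k"
        unfolding E_def \<mu>s_def using \<delta>_nonneg[of k] \<delta>_half[of k]
        by (intro lyap_contracts_asym[OF step asym[OF dk(2)]]) auto
      have 2: "(1 - 6 * D) * E (Suc k) \<le> lyap \<mu> L f xs (x (Suc k), y (Suc k)) (\<mu>s k)"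
        unfolding E_def \<mu>s_def D_def using \<delta>_nonneg[of "Suc k"] \<delta>_half[of k] \<delta>_Suc[of k]
        by (intro lyap_shift_increment[OF asym[OF dk(1)]]) auto
      have "1 + c k * \<alpha> - D * \<alpha>\<^sup>2 \<le> (1 + ?c0 * \<alpha>) * (1 - 6 * D)"
      proof -
        have "c k * \<alpha> = ?c0 * \<alpha> - D * (\<gamma> * \<alpha>)"
          by (simp add: c_def b_def D_def[symmetric] algebra_simps)
        moreover have "?c0 * \<alpha> * D \<le> 2 * \<alpha> * D"
          using c0 \<alpha>_pos D by (intro mult_right_mono) auto
        moreover have "0 \<le> D * \<alpha>\<^sup>2" using D by simp
        ultimately show ?thesis unfolding \<gamma>(2) by (simp add: algebra_simps)
      qed
      then have "(1 + c k * \<alpha> - D * \<alpha>\<^sup>2) * E (Suc k) \<le> (1 + ?c0 * \<alpha>) * (1 - 6 * D) * E (Suc k)"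
        using E_nonneg by (intro mult_right_mono) auto
      also have "\<dots> \<le> (1 + ?c0 * \<alpha>) * lyap \<mu> L f xs (x (Suc k), y (Suc k)) (\<mu>s k)"
        unfolding mult.assoc using 2 c0 \<alpha>_pos by (intro mult_left_mono) auto
      also note 1
      finally show ?thesis
        using k den[of k] by (simp add: r_def hnag_rate_def D_def field_simps)
    qed
    have r_lim: "r \<longlonglongrightarrow> inverse (1 + 2 * \<alpha>)"
    proof -
      have "(\<lambda>k. inverse (1 + c k * \<alpha> - (\<delta> k - \<delta> (Suc k)) * \<alpha>\<^sup>2)) \<longlonglongrightarrow> inverse (1 + 2 * \<alpha> - 0 * \<alpha>\<^sup>2)"
        using \<alpha>_pos by (intro tendsto_intros c_lim \<Delta>_lim) auto
      then have "(\<lambda>k. inverse (1 + c k * \<alpha> - (\<delta> k - \<delta> (Suc k)) * \<alpha>\<^sup>2)) \<longlonglongrightarrow> inverse (1 + 2 * \<alpha>)"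
        by simp
      then show ?thesis
      proof (rule Lim_transform_eventually)
        show "\<forall>\<^sub>F k in sequentially. inverse (1 + c k * \<alpha> - (\<delta> k - \<delta> (Suc k)) * \<alpha>\<^sup>2) = r k"
          using eventually_ge_at_top[of K] by eventually_elim (simp add: r_def hnag_rate_def)
      qed
    qed
    have dist_le: "\<mu> / 2 * (norm (y k - xs))\<^sup>2 \<le> E k" for k
      unfolding E_def by (intro lyap_ge_dist \<mu>s)
    have E_ev: "\<forall>\<^sub>F k in sequentially. E (Suc k) \<le> r k * E k"
      using eventually_ge_at_top[of "max K N"] by eventually_elim (rule E_step)
    obtain C where C: "0 < C" "\<And>k. E (Suc k) \<le> C * (\<Prod>i=0..k. r i)"
      using prod_bound_of_eventual_contraction[where E = E and r = r, OF r_pos E_step] by blast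
    have lin1: "R_linear E (inverse (1 + 2 * \<alpha>))"
      by (rule R_linear_of_ratio_limit[where E = E and M = 1, OF E_nonneg E_ev r_lim])
        (use \<alpha>_pos E_nonneg in auto)
    have lin2: "R_linear (\<lambda>k. (norm (y k - xs))\<^sup>2) (inverse (1 + 2 * \<alpha>))"
      by (rule R_linear_of_ratio_limit[where E = E and M = "2 / \<mu>", OF E_nonneg E_ev r_lim])
        (use \<alpha>_pos \<mu>_pos dist_le in \<open>auto simp: field_simps\<close>)
    show ?thesis
      unfolding rate
      by (rule exI[of _ \<mu>s], rule exI[of _ \<delta>], rule exI[of _ b], rule exI[of _ c], rule exI[of _ C])
        (use \<mu>s(1) \<delta>_nonneg b_nonneg order_trans[OF zero_le_one c_ge] C \<open>decseq \<delta>\<close>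
            \<open>\<delta> \<longlonglongrightarrow> 0\<close> b_lim c_lim lin1 lin2 dist_le
          in \<open>simp add: \<mu>s_def[abs_def] c_def[abs_def] E_def[abs_def] r_def\<close>)
  qed

  ultimately show ?thesis using rate_expansion by blast
qed

end
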